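(* Let $A$ be a non-split, non-Lie, non-nilpotent, solvable (left) Leibniz algebra over $\mathbb{C}$ with $\dim(A^2)=1$, where $A^2=[A,A]$. Then $\dim(A)=2$ and $A$ has a basis $\{x_1,x_2\}$ in which the nonzero products of basis vectors are exactly $$[x_1,x_1]=x_2,\qquad [x_1,x_2]=x_2.$$
   Context: All algebras are over $\mathbb{C}$. A (left) Leibniz algebra is a $\mathbb{C}$-vector space $A$ with a bilinear product $[\,,\,]:A\times A\to A$ such that every left multiplication operator is a derivation: $[a,[b,c]]=[[a,b],c]+[b,[a,c]]$ for all $a,b,c\in A$. For subspaces $U,W$, $[U,W]$ denotes the span of all products $[u,w]$. $A$ is a Lie algebra iff $Leib(A)=\mathrm{span}\{[a,a]\mid a\in A\}$ is zero; non-Lie means $Leib(A)\neq 0$. Put $A^1=A=A^{(1)}$, $A^i=[A,A^{i-1}]$, $A^{(i)}=[A^{(i-1)},A^{(i-1)}]$ for $i\ge 2$; $A$ is nilpotent (resp. solvable) if $A^m=0$ (resp. $A^{(m)}=0$) for some positive integer $m$. $A$ is split if it is a direct sum of two nontrivial (nonzero) ideals (two-sided), and non-split otherwise. *)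

theory Defs
  imports Complex_Main
begin

text \<open>The algebra \<open>A\<close> is the whole type \<open>'a\<close>; no finiteness of its dimension is assumed.\<close>

locale leibniz_algebra = vector_space scale
  for scale :: "complex \<Rightarrow> 'a::ab_group_add \<Rightarrow> 'a" +
  fixes br :: "'a \<Rightarrow> 'a \<Rightarrow> 'a"
  assumes linear_right: "Vector_Spaces.linear scale scale (\<lambda>b. br a b)"
    and linear_left: "Vector_Spaces.linear scale scale (\<lambda>a. br a b)"
    and leibniz: "br a (br b c) = br (br a b) c + br b (br a c)"
begin

definition product_space :: "'a set \<Rightarrow> 'a set \<Rightarrow> 'a set" where
  "product_space U W = span {br u w | u w. u \<in> U \<and> w \<in> W}"

definition Leib :: "'a set" where
  "Leib = span {br a a | a. True}"

definition is_lie :: bool where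
  "is_lie \<longleftrightarrow> Leib = {0}"

text \<open>Both series start at index 1; the value at index 0 is a dummy.\<close>

fun lower_power :: "nat \<Rightarrow> 'a set" where
  "lower_power 0 = UNIV"
| "lower_power (Suc 0) = UNIV"
| "lower_power (Suc (Suc n)) = product_space UNIV (lower_power (Suc n))"

fun derived_power :: "nat \<Rightarrow> 'a set" where
  "derived_power 0 = UNIV"
| "derived_power (Suc 0) = UNIV"
| "derived_power (Suc (Suc n)) =
     product_space (derived_power (Suc n)) (derived_power (Suc n))"

definition nilpotent :: bool where
  "nilpotent \<longleftrightarrow> (\<exists>m\<ge>1. lower_power m = {0})"

definition solvable :: bool where
  "solvable \<longleftrightarrow> (\<exists>m\<ge>1. derived_power m = {0})"

definition two_sided_ideal :: "'a set \<Rightarrow> bool" where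
  "two_sided_ideal I \<longleftrightarrow>
     subspace I \<and> (\<forall>a. \<forall>i\<in>I. br a i \<in> I \<and> br i a \<in> I)"

definition split :: bool where
  "split \<longleftrightarrow>
     (\<exists>I J. two_sided_ideal I \<and> two_sided_ideal J \<and> I \<noteq> {0} \<and> J \<noteq> {0} \<and>
            I \<inter> J = {0} \<and> {i + j | i j. i \<in> I \<and> j \<in> J} = UNIV)"

end

end

theory Submission imports Defs begin

text \<open>
  Write \<open>A\<^sup>2 = span {z}\<close>, so that \<open>[a, b] = f a b z\<close> for a bilinear form \<open>f\<close>. Since
  squares annihilate from the left and \<open>A\<close> is non-Lie, \<open>[z, a] = 0\<close> for all \<open>a\<close>, and the
  Leibniz identity becomes \<open>f b c * f a z = f a c * f b z\<close>. Non-nilpotency gives an \<open>x\<close> with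
  \<open>[x, z] = z\<close>, and adding a multiple of \<open>z\<close> to it also yields \<open>[x, x] = z\<close>. Then \<open>A\<close> is the
  direct sum of the ideal \<open>span {x, z}\<close> and the two-sided annihilator of \<open>A\<close>, which must
  therefore vanish.
\<close>

context leibniz_algebra
begin

sublocale right: Vector_Spaces.linear scale scale "\<lambda>b. br a b" for a
  by (rule linear_right)

sublocale left: Vector_Spaces.linear scale scale "\<lambda>a. br a b" for b
  by (rule linear_left)

lemmas br_simps = right.add right.diff right.scale
  left.add left.diff left.scale

text \<open>In the Leibniz identity with equal left factors, the terms \<open>br a (br a c)\<close>
  cancel, leaving \<open>br (br a a) c = 0\<close>. The left annihilator of \<open>c\<close> is a
  subspace, so it contains the span of all squares.\<close>

lemma br_Leib_left:
  assumes "u \<in> Leib"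
  shows "br u c = 0"
proof -
  have "br (br a a) c = 0" for a
    using leibniz[of a a c] by simp
  then have "{br a a |a. True} \<subseteq> {u. br u c = 0}"
    by blast
  then show ?thesis
    using assms span_minimal[OF _ left.subspace_kernel[of c]] unfolding Leib_def by blast
qed

definition annihilator :: "'a set" where
  "annihilator = {k. \<forall>a. br a k = 0 \<and> br k a = 0}"

lemma two_sided_ideal_annihilator: "two_sided_ideal annihilator"
  unfolding two_sided_ideal_def annihilator_def subspace_def
  by (auto simp: br_simps)

lemma lower_power_2: "lower_power 2 = span {br a b |a b. True}"
  by (simp add: numeral_2_eq_2 product_space_def)

lemma two_sided_ideal_supset:
  assumes "subspace I" "\<And>a b. br a b \<in> I"
  shows "two_sided_ideal I"
  using assms by (simp add: two_sided_ideal_def)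

lemma nonsplit_complement_eq_0:
  assumes "\<not> split" "two_sided_ideal I" "two_sided_ideal J" "I \<noteq> {0}"
    and "I \<inter> J \<subseteq> {0}" "\<And>a. \<exists>i\<in>I. \<exists>j\<in>J. a = i + j"
  shows "J = {0}"
proof -
  have "0 \<in> I" "0 \<in> J"
    using assms(2,3) by (auto simp: two_sided_ideal_def subspace_0)
  then have "I \<inter> J = {0}"
    using assms(5) by blast
  moreover have "{i + j |i j. i \<in> I \<and> j \<in> J} = UNIV"
    using assms(6) by blast
  ultimately show ?thesis
    using assms(1-4) unfolding split_def by blast
qed

lemma dim_lower_power_2_eq_1E:
  assumes "dim (lower_power 2) = 1"
  obtains z where "z \<noteq> 0" "lower_power 2 = span {z}" "\<And>a b. \<exists>r. br a b = scale r z"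
proof -
  have sub: "subspace (lower_power 2)"
    by (simp add: lower_power_2)
  obtain B where B: "B \<subseteq> lower_power 2" "independent B" "lower_power 2 \<subseteq> span B"
      "card B = 1"
    using basis_exists[of "lower_power 2"] assms by metis
  then obtain z where z: "B = {z}"
    by (auto simp: card_1_singleton_iff)
  have "z \<noteq> 0"
    using B(2) z dependent_zero by blast
  moreover have eq: "lower_power 2 = span {z}"
    using B(1,3) z span_minimal[OF B(1) sub] by blast
  moreover have "\<exists>r. br a b = scale r z" for a b
  proof -
    have "br a b \<in> span {z}"
      unfolding eq[symmetric] lower_power_2 by (rule span_base) blast
    then show ?thesis
      by (auto simp: span_singleton)
  qed
  ultimately show ?thesis
    by (rule that)
qed

text \<open>If every left multiplication killed \<open>z\<close>, the third term [A, A^2] of the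
  lower series would vanish.\<close>

lemma non_nilpotent_acts:
  assumes "\<not> nilpotent" "lower_power 2 = span {z}"
  shows "\<exists>a. br a z \<noteq> 0"
proof (rule ccontr)
  assume "\<not> ?thesis"
  then have "br u w = 0" if "w \<in> lower_power 2" for u w
    using that assms(2) by (auto simp: span_singleton br_simps)
  then have "{br u w |u w. u \<in> UNIV \<and> w \<in> lower_power 2} \<subseteq> {0}"
    by blast
  then have "lower_power 3 \<subseteq> span {0}"
    unfolding numeral_3_eq_3 numeral_2_eq_2 lower_power.simps(3) product_space_def
    by (rule span_mono)
  then have "lower_power 3 = {0}"
    using span_zero by (auto simp: numeral_3_eq_3 product_space_def)
  then show False
    using assms(1) unfolding nilpotent_def by (meson one_le_numeral)
qed

text \<open>\<open>Leib\<close> is a nonzero subspace of the line spanned by \<open>z\<close>, so it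
  contains a nonzero multiple of \<open>z\<close>, and elements of \<open>Leib\<close> annihilate
  from the left.\<close>

lemma non_lie_annihilates_left:
  assumes "\<not> is_lie" "lower_power 2 = span {z}"
  shows "br z c = 0"
proof -
  have "Leib \<subseteq> span {z}"
    unfolding Leib_def assms(2)[symmetric] lower_power_2 by (rule span_mono) blast
  moreover have "0 \<in> Leib"
    by (simp add: Leib_def span_zero)
  ultimately obtain r where r: "scale r z \<in> Leib" "scale r z \<noteq> 0"
    using assms(1) unfolding is_lie_def span_singleton by blast
  then have "scale r (br z c) = 0"
    using br_Leib_left[OF r(1), of c] by (simp add: br_simps)
  then show ?thesis
    using r(2) by auto
qed

theorem classification_dim_lower_power_2_eq_1:
  assumes "\<not> split" "\<not> is_lie" "\<not> nilpotent" "dim (lower_power 2) = 1"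
  obtains x z where "x \<noteq> z" "independent {x, z}" "span {x, z} = UNIV"
    "br x x = z" "br x z = z" "br z x = 0" "br z z = 0"
proof -
  obtain z where z: "z \<noteq> 0" and A2: "lower_power 2 = span {z}"
    and "\<And>a b. \<exists>r. br a b = scale r z"
    using dim_lower_power_2_eq_1E[OF assms(4)] by blast
  then obtain f where f: "\<And>a b. br a b = scale (f a b) z"
    by metis
  have zl: "br z c = 0" for c
    using non_lie_annihilates_left[OF assms(2) A2] .
  \<comment> \<open>The term \<open>br (br a b) c\<close> drops out because \<open>br a b\<close> is
    a multiple of \<open>z\<close>; what remains says that left multiplications commute.\<close>
  have f_swap: "f b c * f a z = f a c * f b z" for a b c
  proof -
    have "scale (f b c * f a z) z = br a (br b c)"
      by (simp add: f[of b c] right.scale f[of a z])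
    also have "\<dots> = br b (br a c)"
      unfolding leibniz[of a b c] by (simp add: f[of a b] left.scale zl)
    also have "\<dots> = scale (f a c * f b z) z"
      by (simp add: f[of a c] right.scale f[of b z])
    finally show ?thesis
      using z by simp
  qed
  obtain a where "br a z \<noteq> 0"
    using non_nilpotent_acts[OF assms(3) A2] by blast
  then have a: "f a z \<noteq> 0"
    using f[of a z] by auto
  define y where "y = scale (inverse (f a z)) a"
  have yz: "br y z = z"
    using a by (simp add: y_def left.scale f[of a z])
  \<comment> \<open>Since \<open>z\<close> annihilates from the left, adding
    \<open>scale t z\<close> to \<open>y\<close> keeps \<open>br y z = z\<close> and changes the
    square only by \<open>scale t (br y z) = scale t z\<close>; the choice
    \<open>t = 1 - f y y\<close> makes the square equal to \<open>z\<close>.\<close>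
  define x where "x = y + scale (1 - f y y) z"
  have xz: "br x z = z"
    by (simp add: x_def br_simps zl yz)
  have "br x x = scale (f y y) z + scale (1 - f y y) z"
    by (simp add: x_def br_simps zl yz f[of y y])
  then have xx: "br x x = z"
    by (simp add: scale_left_distrib[symmetric])
  have fxz: "f x z = 1"
    using xz f[of x z] z by (metis scale_one scale_cancel_right)
  \<comment> \<open>The form is a product of two linear functionals, \<open>f _ z\<close> and
    \<open>f x _\<close>, so any element killed by both lies in \<open>annihilator\<close>.\<close>
  have f_eq: "f a c = f a z * f x c" for a c
    using f_swap[of x c a] fxz by (simp add: mult.commute)
  \<comment> \<open>The two products used below are \<open>scale r z\<close> and
    \<open>scale (r + s) z\<close>.\<close>
  have indep: "r = 0 \<and> s = 0" if "scale r x + scale s z \<in> annihilator" for r s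
  proof -
    have "br (scale r x + scale s z) z = 0" "br x (scale r x + scale s z) = 0"
      using that unfolding annihilator_def by auto
    then show ?thesis
      using z by (simp add: br_simps zl xz xx)
  qed
  let ?I = "span {x, z}"
  have I: "u \<in> ?I \<longleftrightarrow> (\<exists>r s. u = scale r x + scale s z)" for u
    by (auto simp: span_insert span_singleton algebra_simps)
  have decomp: "\<exists>i\<in>?I. \<exists>j\<in>annihilator. b = i + j" for b
  proof -
    \<comment> \<open>On \<open>scale r x + scale s z\<close> the functionals \<open>f _ z\<close>
      and \<open>f x _\<close> take the values \<open>r\<close> and \<open>r + s\<close>. The
      coefficients are solved so that these agree with the values at \<open>b\<close>.\<close>
    define i where "i = scale (f b z) x + scale (f x b - f b z) z"
    have "br x (b - i) = 0"
      by (simp add: i_def br_simps xx xz f[of x b] scale_left_distrib[symmetric])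
    then have "f x (b - i) = 0"
      using z f by simp
    moreover have "br (b - i) z = 0"
      by (simp add: i_def br_simps zl xz f[of b z])
    then have "f (b - i) z = 0"
      using z f by simp
    ultimately have "f a (b - i) = 0" "f (b - i) a = 0" for a
      using f_eq[of a "b - i"] f_eq[of "b - i" a] by simp_all
    then have "b - i \<in> annihilator"
      by (simp add: annihilator_def f)
    moreover have "i \<in> ?I"
      unfolding I i_def by blast
    ultimately show ?thesis
      by (intro bexI[of _ i] bexI[of _ "b - i"]) simp_all
  qed
  have "annihilator = {0}"
  proof (rule nonsplit_complement_eq_0[OF assms(1)])
    show "two_sided_ideal ?I"
      \<comment> \<open>Every product is a multiple of \<open>z\<close>, hence lies in
        \<open>?I\<close>.\<close>
      by (rule two_sided_ideal_supset) (auto simp: f span_base span_scale)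
    show "two_sided_ideal annihilator"
      by (rule two_sided_ideal_annihilator)
    show "?I \<noteq> {0}"
      using z span_base[of z "{x, z}"] by auto
    show "?I \<inter> annihilator \<subseteq> {0}"
      using I indep by force
    show "\<exists>i\<in>?I. \<exists>j\<in>annihilator. b = i + j" for b
      by (rule decomp)
  qed
  then have "b \<in> ?I" for b
    using decomp[of b] by simp
  then have span: "?I = UNIV"
    by blast
  have "x \<notin> span {z}"
  proof
    assume "x \<in> span {z}"
    then obtain r where "x = scale r z"
      by (auto simp: span_singleton)
    then have "br x z = 0"
      by (simp add: left.scale zl)
    then show False
      using xz z by simp
  qed
  then have "independent {x, z}" "x \<noteq> z"
    using z by (auto simp: independent_insert span_base)
  then show ?thesis
    using that[of x z] span xx xz zl by simp
qed

end

theorem theorem2p7: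
  fixes scale :: "complex \<Rightarrow> 'a::ab_group_add \<Rightarrow> 'a"
    and br :: "'a \<Rightarrow> 'a \<Rightarrow> 'a"
  assumes "leibniz_algebra scale br"
    and "\<not> leibniz_algebra.split scale br"
    and "\<not> leibniz_algebra.is_lie scale br"
    and "\<not> leibniz_algebra.nilpotent scale br"
    and "leibniz_algebra.solvable scale br"
    and "vector_space.dim scale (leibniz_algebra.lower_power scale br 2) = 1"
  shows "vector_space.dim scale (UNIV :: 'a set) = 2 \<and>
    (\<exists>x1 x2. x1 \<noteq> x2 \<and>
       \<not> module.dependent scale {x1, x2} \<and> module.span scale {x1, x2} = UNIV \<and>
       br x1 x1 = x2 \<and> br x1 x2 = x2 \<and> br x2 x1 = 0 \<and> br x2 x2 = 0)"
proof -
  interpret leibniz_algebra scale br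
    by (rule assms(1))
  obtain x z where xz: "x \<noteq> z" "independent {x, z}" "span {x, z} = UNIV"
    and "br x x = z" "br x z = z" "br z x = 0" "br z z = 0"
    using classification_dim_lower_power_2_eq_1[OF assms(2,3,4,6)] .
  moreover have "dim UNIV = 2"
    using dim_eq_card[OF _ xz(2), of UNIV] xz by simp
  ultimately show ?thesis
    by (intro conjI exI[of _ x] exI[of _ z])
qed

end
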